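(* Let $k\ge2$ and $r\ge 1$, let $G$ be a connected $k$-uniform hypergraph, and let $G'$ be the hypergraph obtained from $G$ by moving edges $(e_1,\dots,e_r)$ from $(v_1,\dots,v_r)$ to $u$. Suppose that $G'$ contains no multiple edges. Then: (1) If $x$ is the principal eigenvector of $\mathcal{A}(G)$ corresponding to $\rho(\mathcal{A}(G))$ and $x_u\ge \max_{1\leq i\leq r}\{x_{v_i}\}$, then $\rho(\mathcal{A}(G'))>\rho(\mathcal{A}(G))$. (2) If $x$ is the principal eigenvector of $\mathcal{Q}(G)$ corresponding to $\rho(\mathcal{Q}(G))$ and $x_u\ge \max_{1\leq i\leq r}\{x_{v_i}\}$, then $\rho(\mathcal{Q}(G'))>\rho(\mathcal{Q}(G))$. (3) If $x$ is the principal eigenvector of $\mathcal{Q}^{*}(G)$ corresponding to $\rho(\mathcal{Q}^{*}(G))$ and $x_u\ge \max_{1\leq i\leq r}\{x_{v_i}\}$, then $\rho(\mathcal{Q}^{*}(G'))>\rho(\mathcal{Q}^{*}(G))$.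
   Context: Hypergraphs. A $k$-uniform hypergraph $G=(V,E)$ has finite vertex set $V=[n]=\{1,\dots,n\}$ and a set $E$ of $k$-element subsets of $V$ (the edges; no repeated edges). The degree $d_i$ of a vertex $i$ is the number of edges containing $i$. A path is a sequence $w_1,f_1,w_2,\dots,w_q,f_q,w_{q+1}$ with distinct vertices $w_j$, distinct edges $f_j$, and $w_j,w_{j+1}\in f_j$ for all $j$; $G$ is connected if any two vertices are joined by a path. Moving edges. Let $u\in V$ and let $e_1,\dots,e_r\in E$ ($r\ge1$) be distinct edges with $u\notin e_i$ for all $i$. Let $v_i\in e_i$ (the $v_i$ need not be distinct) and put $e_i'=(e_i\setminus\{v_i\})\cup\{u\}$. The hypergraph $G'=(V,E')$ with $E'=(E\setminus\{e_1,\dots,e_r\})\cup\{e_1',\dots,e_r'\}$ is said to be obtained from $G$ by moving edges $(e_1,\dots,e_r)$ from $(v_1,\dots,v_r)$ to $u$. That $G'$ contains no multiple edges means that $e_1',\dots,e_r'$ are pairwise distinct and none of them belongs to $E\setminus\{e_1,\dots,e_r\}$. Tensors. For a real order-$k$ dimension-$n$ tensor $\mathcal{T}=(\mathcal{T}_{i_1\cdots i_k})$ and $x\in\mathbb{C}^n$, $\mathcal{T}x\in\mathbb{C}^n$ is defined by $(\mathcal{T}x)_i=\sum_{i_2,\dots,i_k=1}^n\mathcal{T}_{ii_2\cdots i_k}x_{i_2}\cdots x_{i_k}$. A number $\lambda\in\mathbb{C}$ is an eigenvalue of $\mathcal{T}$ with eigenvector $0\ne x\in\mathbb{C}^n$ if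 $(\mathcal{T}x)_i=\lambda x_i^{k-1}$ for all $i$. The spectral radius $\rho(\mathcal{T})$ is the maximum modulus of an eigenvalue of $\mathcal{T}$. If $\mathcal{T}$ is one of the tensors $\mathcal{A}(G),\mathcal{Q}(G),\mathcal{Q}^*(G)$ below with $G$ connected, then by the Perron-Frobenius theorem (these tensors are weakly irreducible and nonnegative) $\mathcal{T}$ has a unique positive eigenvector $x$ corresponding to $\rho(\mathcal{T})$ with $\sum_{i}x_i^k=1$; it is called the principal eigenvector of $\mathcal{T}$. For a $k$-uniform hypergraph $G$: the adjacency tensor $\mathcal{A}(G)$ has entries $a_{i_1\cdots i_k}=\frac1{(k-1)!}$ if $\{i_1,\dots,i_k\}\in E$ and $0$ otherwise; the signless Laplacian tensor is $\mathcal{Q}(G)=\mathcal{D}(G)+\mathcal{A}(G)$ where $\mathcal{D}(G)$ is the diagonal tensor with $\mathcal{D}_{i\cdots i}=d_i$; the incidence $Q$-tensor $\mathcal{Q}^*(G)$ has $(i_1,\dots,i_k)$-entry equal to the number of edges $e$ with $i_t\in e$ for all $t=1,\dots,k$ (indices may repeat). *)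

theory Defs
  imports "HOL-Analysis.Analysis"
begin

text \<open>
  The vertex set \<open>[n]\<close> is the universe of a finite type \<open>'n\<close>, so \<open>n = CARD('n)\<close> and
  \<open>\<complex>\<^sup>n\<close> is \<open>complex ^ 'n\<close>. A hypergraph on it is given by its set of edges.
\<close>

definition uniform :: "nat \<Rightarrow> 'n::finite set set \<Rightarrow> bool" where
  "uniform k E \<longleftrightarrow> (\<forall>e\<in>E. card e = k)"

definition degree :: "'n::finite set set \<Rightarrow> 'n \<Rightarrow> nat" where
  "degree E i = card {e \<in> E. i \<in> e}"

text \<open>
  The path \<open>w\<^sub>1, f\<^sub>1, w\<^sub>2, \<dots>, f\<^sub>q, w\<^sub>q\<^sub>+\<^sub>1\<close> is split into its vertex list \<open>ws\<close> and its edge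
  list \<open>fs\<close>, both indexed from 0. The case \<open>q = 0\<close> joins a vertex to itself.
\<close>

definition hyperpath :: "'n::finite set set \<Rightarrow> 'n list \<Rightarrow> 'n set list \<Rightarrow> bool" where
  "hyperpath E ws fs \<longleftrightarrow>
     length ws = length fs + 1 \<and> distinct ws \<and> distinct fs \<and> set fs \<subseteq> E \<and>
     (\<forall>j < length fs. ws ! j \<in> fs ! j \<and> ws ! (j + 1) \<in> fs ! j)"

definition hyperconnected :: "'n::finite set set \<Rightarrow> bool" where
  "hyperconnected E \<longleftrightarrow>
     (\<forall>a b. \<exists>ws fs. hyperpath E ws fs \<and> hd ws = a \<and> last ws = b)"

definition moved_edge :: "(nat \<Rightarrow> 'n set) \<Rightarrow> (nat \<Rightarrow> 'n) \<Rightarrow> 'n \<Rightarrow> nat \<Rightarrow> 'n::finite set" where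
  "moved_edge e v u i = (e i - {v i}) \<union> {u}"

definition movable ::
  "'n::finite set set \<Rightarrow> nat \<Rightarrow> (nat \<Rightarrow> 'n set) \<Rightarrow> (nat \<Rightarrow> 'n) \<Rightarrow> 'n \<Rightarrow> bool" where
  "movable E r e v u \<longleftrightarrow>
     inj_on e {1..r} \<and> (\<forall>i\<in>{1..r}. e i \<in> E \<and> u \<notin> e i \<and> v i \<in> e i)"

definition move_edges ::
  "'n::finite set set \<Rightarrow> nat \<Rightarrow> (nat \<Rightarrow> 'n set) \<Rightarrow> (nat \<Rightarrow> 'n) \<Rightarrow> 'n \<Rightarrow> 'n set set" where
  "move_edges E r e v u = (E - e ` {1..r}) \<union> moved_edge e v u ` {1..r}"

text \<open>
  Since the edges of \<^const>\<open>move_edges\<close> form a set, coincidences among the moved edges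
  would be merged silently; they have to be excluded beforehand.
\<close>

definition no_multiple_edges ::
  "'n::finite set set \<Rightarrow> nat \<Rightarrow> (nat \<Rightarrow> 'n set) \<Rightarrow> (nat \<Rightarrow> 'n) \<Rightarrow> 'n \<Rightarrow> bool" where
  "no_multiple_edges E r e v u \<longleftrightarrow>
     inj_on (moved_edge e v u) {1..r} \<and>
     (\<forall>i\<in>{1..r}. moved_edge e v u i \<notin> E - e ` {1..r})"

text \<open>
  A real tensor of order \<open>k\<close> maps index lists of length \<open>k\<close> to its entries; the values on
  lists of other lengths are never used.
\<close>

type_synonym 'n tensor = "'n list \<Rightarrow> real"

definition tensor_apply :: "nat \<Rightarrow> 'n::finite tensor \<Rightarrow> complex ^ 'n \<Rightarrow> complex ^ 'n" where
  "tensor_apply k T x =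
     (\<chi> i. \<Sum>js | length js = k - 1. complex_of_real (T (i # js)) * (\<Prod>j\<leftarrow>js. x $ j))"

definition eigenpair :: "nat \<Rightarrow> 'n::finite tensor \<Rightarrow> complex \<Rightarrow> complex ^ 'n \<Rightarrow> bool" where
  "eigenpair k T l x \<longleftrightarrow> x \<noteq> 0 \<and> (\<forall>i. tensor_apply k T x $ i = l * (x $ i) ^ (k - 1))"

definition eigenvalue :: "nat \<Rightarrow> 'n::finite tensor \<Rightarrow> complex \<Rightarrow> bool" where
  "eigenvalue k T l \<longleftrightarrow> (\<exists>x. eigenpair k T l x)"

definition spectral_radius :: "nat \<Rightarrow> 'n::finite tensor \<Rightarrow> real" where
  "spectral_radius k T = (GREATEST m. \<exists>l. eigenvalue k T l \<and> m = cmod l)"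

definition principal_eigenvector :: "nat \<Rightarrow> 'n::finite tensor \<Rightarrow> real ^ 'n \<Rightarrow> bool" where
  "principal_eigenvector k T x \<longleftrightarrow>
     eigenpair k T (complex_of_real (spectral_radius k T)) (\<chi> i. complex_of_real (x $ i)) \<and>
     (\<forall>i. x $ i > 0) \<and> (\<Sum>i\<in>UNIV. (x $ i) ^ k) = 1"

definition adjacency_tensor :: "nat \<Rightarrow> 'n::finite set set \<Rightarrow> 'n tensor" where
  "adjacency_tensor k E js = (if set js \<in> E then 1 / fact (k - 1) else 0)"

definition degree_tensor :: "nat \<Rightarrow> 'n::finite set set \<Rightarrow> 'n tensor" where
  "degree_tensor k E js =
     (if \<exists>i. js = replicate k i then real (degree E (hd js)) else 0)"

definition signless_laplacian_tensor :: "nat \<Rightarrow> 'n::finite set set \<Rightarrow> 'n tensor" where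
  "signless_laplacian_tensor k E js = degree_tensor k E js + adjacency_tensor k E js"

definition incidence_Q_tensor :: "nat \<Rightarrow> 'n::finite set set \<Rightarrow> 'n tensor" where
  "incidence_Q_tensor k E js = real (card {e \<in> E. \<forall>t<k. js ! t \<in> e})"

end

theory Submission
  imports Defs
begin

text \<open>
  For a nonnegative symmetric tensor \<open>T\<close> of order \<open>k\<close> the spectral radius is the maximum of the
  form \<open>F\<^sub>T y = \<Sum> T\<^bsub>i\<^sub>1\<dots>i\<^sub>k\<^esub> y\<^bsub>i\<^sub>1\<^esub>\<dots>y\<^bsub>i\<^sub>k\<^esub>\<close> over the vectors \<open>y \<ge> 0\<close> with \<open>\<Sum> y\<^sub>i\<^sup>k = 1\<close>. The maximum bounds every
  eigenvalue in modulus, as one sees by passing to absolute values in the eigenvalue equations,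
  and by the first order conditions a maximiser satisfies the eigenvalue equations
  (\<open>form_maximiser_eigen\<close>), so that the maximum is itself an eigenvalue.

  Each of the three tensors of a hypergraph is a sum over the edges of a nonnegative symmetric
  tensor attached to the edge, and this assignment commutes with permutations of the vertices
  (locale \<open>edge_kernel\<close>). The transposition of \<open>v\<^sub>i\<close> and \<open>u\<close> maps \<open>e\<^sub>i\<close> to the moved edge. Since
  \<open>x\<^sub>u \<ge> x\<^bsub>v\<^sub>i\<^esub>\<close>, it does not decrease any monomial of the form belonging to \<open>e\<^sub>i\<close>, so the form of
  the new hypergraph at \<open>x\<close> is at least that of the old one, which is the old spectral radius.
  If the spectral radii were equal, then \<open>x\<close> would be a maximiser for the new hypergraph too and
  would satisfy both systems of eigenvalue equations with the same eigenvalue. But in the equation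
  of \<open>u\<close> the moved edges add strictly positive terms and nothing is lost. As the new spectral radius
  enters only through the form, it does not matter that the new hypergraph may be disconnected.
\<close>

section \<open>The form of a real tensor\<close>

text \<open>The homogeneous form \<open>y\<^sup>T (T y)\<close> of degree \<open>k\<close> that belongs to a tensor of order \<open>k\<close>.\<close>

definition tensor_form :: "nat \<Rightarrow> 'n::finite tensor \<Rightarrow> real ^ 'n \<Rightarrow> real" where
  "tensor_form k T y = (\<Sum>js | length js = k. T js * (\<Prod>j\<leftarrow>js. y $ j))"

text \<open>The vector \<open>T y\<close> for real \<open>y\<close>, as a real function of the index.\<close>

definition real_apply :: "nat \<Rightarrow> 'n::finite tensor \<Rightarrow> real ^ 'n \<Rightarrow> 'n \<Rightarrow> real" where
  "real_apply k T y i = (\<Sum>js | length js = k - 1. T (i # js) * (\<Prod>j\<leftarrow>js. y $ j))"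

lemma finite_lists_of_length [simp]: "finite {js :: 'n::finite list. length js = k}"
  using finite_lists_length_eq[of "UNIV :: 'n set" k] by simp

lemma prod_list_map_nonneg:
  fixes f :: "'a \<Rightarrow> real"
  assumes "\<And>j. j \<in> set js \<Longrightarrow> 0 \<le> f j"
  shows "0 \<le> (\<Prod>j\<leftarrow>js. f j)"
  using assms by (induction js) auto

lemma prod_list_map_pos:
  fixes f :: "'a \<Rightarrow> real"
  assumes "\<And>j. 0 < f j"
  shows "0 < (\<Prod>j\<leftarrow>js. f j)"
  using assms by (induction js) auto

lemma prod_list_map_mono:
  fixes f g :: "'a \<Rightarrow> real"
  assumes "\<And>j. j \<in> set js \<Longrightarrow> 0 \<le> f j \<and> f j \<le> g j"
  shows "(\<Prod>j\<leftarrow>js. f j) \<le> (\<Prod>j\<leftarrow>js. g j)"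
  using assms
proof (induction js)
  case (Cons a js)
  have "0 \<le> (\<Prod>j\<leftarrow>js. f j)"
    using Cons.prems by (intro prod_list_map_nonneg) auto
  moreover have "0 \<le> f a" "f a \<le> g a"
    using Cons.prems by auto
  moreover have "(\<Prod>j\<leftarrow>js. f j) \<le> (\<Prod>j\<leftarrow>js. g j)"
    using Cons by simp
  ultimately show ?case
    using mult_mono[of "f a" "g a"] by fastforce
qed simp

lemma norm_prod_list_map:
  fixes f :: "'a \<Rightarrow> complex"
  shows "cmod (\<Prod>j\<leftarrow>js. f j) = (\<Prod>j\<leftarrow>js. cmod (f j))"
  by (induction js) (auto simp: norm_mult)

lemma of_real_prod_list_map:
  "complex_of_real (\<Prod>j\<leftarrow>js. f j) = (\<Prod>j\<leftarrow>js. complex_of_real (f j))"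
  by (induction js) auto

lemma prod_list_map_scale:
  fixes f :: "'a \<Rightarrow> real"
  shows "(\<Prod>j\<leftarrow>js. c * f j) = c ^ length js * (\<Prod>j\<leftarrow>js. f j)"
  by (induction js) auto

lemma tensor_form_eq_sum_apply:
  fixes y :: "real ^ 'n::finite"
  assumes "k \<ge> 1"
  shows "tensor_form k T y = (\<Sum>i\<in>UNIV. y $ i * real_apply k T y i)"
proof -
  let ?A = "UNIV \<times> {js :: 'n list. length js = k - 1}"
  have bij: "bij_betw (\<lambda>(i, js). i # js) ?A {js. length js = k}"
  proof (rule bij_betwI')
    fix js :: "'n list" assume "js \<in> {js. length js = k}"
    then show "\<exists>p\<in>?A. js = (case p of (i, js) \<Rightarrow> i # js)"
      using assms by (cases js) auto
  qed (use assms in auto)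
  have "tensor_form k T y = (\<Sum>(i, js)\<in>?A. T (i # js) * (y $ i * (\<Prod>j\<leftarrow>js. y $ j)))"
    unfolding tensor_form_def
    by (subst sum.reindex_bij_betw[OF bij, symmetric]) (auto intro!: sum.cong)
  also have "\<dots> = (\<Sum>i\<in>UNIV. y $ i * real_apply k T y i)"
    unfolding real_apply_def
    by (subst sum.cartesian_product[symmetric])
       (auto simp: sum_distrib_left mult_ac intro!: sum.cong)
  finally show ?thesis .
qed

lemma tensor_form_scale:
  "tensor_form k T (c *\<^sub>R y) = c ^ k * tensor_form k T y"
  by (simp add: tensor_form_def sum_distrib_left prod_list_map_scale mult_ac)

lemma continuous_on_tensor_form:
  fixes S :: "(real ^ 'n::finite) set"
  shows "continuous_on S (tensor_form k T)"
proof -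
  have "continuous_on S (\<lambda>y :: real ^ 'n. \<Prod>j\<leftarrow>js. y $ j)" for js :: "'n list"
    by (induction js) (auto intro!: continuous_intros)
  then show ?thesis
    unfolding tensor_form_def by (intro continuous_intros)
qed

lemma real_apply_nonneg:
  assumes "\<And>js. 0 \<le> T js" and "\<And>j. 0 \<le> y $ j"
  shows "0 \<le> real_apply k T y i"
  unfolding real_apply_def
  by (intro sum_nonneg mult_nonneg_nonneg prod_list_map_nonneg assms)

section \<open>First order conditions at a maximiser of the form\<close>

lemma DERIV_monomial_direction:
  fixes y :: "real ^ 'n::finite"
  shows "((\<lambda>t. \<Prod>j\<leftarrow>js. y $ j + t * of_bool (j = i)) has_real_derivative
     (\<Sum>p<length js. of_bool (js ! p = i) * (\<Prod>j\<leftarrow>take p js @ drop (Suc p) js. y $ j))) (at 0)"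
proof (induction js)
  case (Cons a js)
  show ?case
    unfolding list.map prod_list.Cons length_Cons sum.lessThan_Suc_shift
    by (rule derivative_eq_intros Cons.IH refl)+
       (simp add: sum_distrib_left mult_ac del: sum_of_bool_mult_eq)
qed simp

text \<open>
  In a symmetric tensor the distinguished index may be moved from any position to the front.
\<close>

lemma sum_fixed_position_eq_apply:
  fixes y :: "real ^ 'n::finite"
  assumes sym: "\<And>js js'. length js = k \<Longrightarrow> mset js = mset js' \<Longrightarrow> T js = T js'"
    and "p < k"
  shows "(\<Sum>js | length js = k. T js *
            (of_bool (js ! p = i) * (\<Prod>j\<leftarrow>take p js @ drop (Suc p) js. y $ j)))
         = real_apply k T y i"
proof -
  let ?ins = "\<lambda>js. take p js @ i # drop p js"
  have "(\<Sum>js | length js = k. T js *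
            (of_bool (js ! p = i) * (\<Prod>j\<leftarrow>take p js @ drop (Suc p) js. y $ j)))
      = (\<Sum>js | length js = k \<and> js ! p = i. T js * (\<Prod>j\<leftarrow>take p js @ drop (Suc p) js. y $ j))"
    by (rule sum.mono_neutral_cong_right) auto
  also have "\<dots> = (\<Sum>js | length js = k - 1. T (i # js) * (\<Prod>j\<leftarrow>js. y $ j))"
  proof (rule sum.reindex_bij_witness[where i = ?ins and j = "\<lambda>js. take p js @ drop (Suc p) js"])
    fix js :: "'n list" assume js: "js \<in> {js. length js = k \<and> js ! p = i}"
    then have len: "length js = k" and nth: "js ! p = i" by auto
    have split: "take p js @ i # drop (Suc p) js = js"
      using len nth \<open>p < k\<close> id_take_nth_drop[of p js] by simp
    show "?ins (take p js @ drop (Suc p) js) = js"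
      using split len \<open>p < k\<close> by simp
    show "take p js @ drop (Suc p) js \<in> {js. length js = k - 1}"
      using len \<open>p < k\<close> by auto
    have "mset (i # take p js @ drop (Suc p) js) = mset js"
      by (subst (3) split[symmetric]) simp
    then have "T (i # take p js @ drop (Suc p) js) = T js"
      using sym len by metis
    then show "T (i # take p js @ drop (Suc p) js) * (\<Prod>j\<leftarrow>take p js @ drop (Suc p) js. y $ j)
        = T js * (\<Prod>j\<leftarrow>take p js @ drop (Suc p) js. y $ j)"
      by simp
  next
    fix js :: "'n list" assume "js \<in> {js. length js = k - 1}"
    then have len: "length js = k - 1" by simp
    show "take p (?ins js) @ drop (Suc p) (?ins js) = js"
      using len \<open>p < k\<close> by (simp add: min_def)
    show "?ins js \<in> {js. length js = k \<and> js ! p = i}"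
      using len \<open>p < k\<close> by (auto simp: nth_append min_def)
  qed
  finally show ?thesis
    unfolding real_apply_def .
qed

lemma DERIV_tensor_form_direction:
  fixes y :: "real ^ 'n::finite"
  assumes sym: "\<And>js js'. length js = k \<Longrightarrow> mset js = mset js' \<Longrightarrow> T js = T js'"
  shows "((\<lambda>t. tensor_form k T (\<chi> j. y $ j + t * of_bool (j = i))) has_real_derivative
           real k * real_apply k T y i) (at 0)"
proof -
  let ?m = "\<lambda>js p. of_bool (js ! p = i) * (\<Prod>j\<leftarrow>take p js @ drop (Suc p) js. y $ j)"
  have "((\<lambda>t. tensor_form k T (\<chi> j. y $ j + t * of_bool (j = i))) has_real_derivative
           (\<Sum>js | length js = k. T js * (\<Sum>p<length js. ?m js p))) (at 0)"
    unfolding tensor_form_def vec_lambda_beta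
    by (intro DERIV_sum DERIV_cmult DERIV_monomial_direction)
  also have "(\<Sum>js | length js = k. T js * (\<Sum>p<length js. ?m js p))
      = (\<Sum>p<k. \<Sum>js | length js = k. T js * ?m js p)"
    unfolding sum_distrib_left by (subst sum.swap) (rule sum.cong, simp_all del: sum_of_bool_mult_eq)
  also have "\<dots> = (\<Sum>p<k. real_apply k T y i)"
    by (intro sum.cong refl sum_fixed_position_eq_apply sym) simp_all
  also have "\<dots> = real k * real_apply k T y i"
    by simp
  finally show ?thesis .
qed

text \<open>
  A nonnegative vector at which the homogenised inequality \<open>F z \<le> m \<Sum> z\<^sub>j\<^sup>k\<close> is tight satisfies the
  eigenvalue equations. On the boundary, where \<open>y\<^sub>i = 0\<close>, only the one-sided condition
  \<open>(T y)\<^sub>i \<le> 0\<close> is available; there the nonnegativity of \<open>T\<close> closes the gap.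
\<close>

lemma form_maximiser_eigen:
  fixes y :: "real ^ 'n::finite"
  assumes "k \<ge> 2"
    and nonneg: "\<And>js. 0 \<le> T js"
    and sym: "\<And>js js'. length js = k \<Longrightarrow> mset js = mset js' \<Longrightarrow> T js = T js'"
    and bound: "\<And>z. (\<And>j. 0 \<le> z $ j) \<Longrightarrow> tensor_form k T z \<le> m * (\<Sum>j\<in>UNIV. (z $ j) ^ k)"
    and y: "\<And>j. 0 \<le> y $ j"
    and tight: "tensor_form k T y = m * (\<Sum>j\<in>UNIV. (y $ j) ^ k)"
  shows "real_apply k T y i = m * (y $ i) ^ (k - 1)"
proof -
  define z where "z t = (\<chi> j. y $ j + t * of_bool (j = i))" for t
  define g where "g t = tensor_form k T (z t) - m * (\<Sum>j\<in>UNIV. (z t $ j) ^ k)" for t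
  define D where "D = real k * (real_apply k T y i - m * (y $ i) ^ (k - 1))"
  have "((\<lambda>t. \<Sum>j\<in>UNIV. (z t $ j) ^ k) has_real_derivative
          (\<Sum>j\<in>UNIV. real k * (y $ j) ^ (k - 1) * of_bool (j = i))) (at 0)"
    unfolding z_def vec_lambda_beta
    by (intro DERIV_sum) (auto intro!: derivative_eq_intros)
  then have "((\<lambda>t. \<Sum>j\<in>UNIV. (z t $ j) ^ k) has_real_derivative real k * (y $ i) ^ (k - 1)) (at 0)"
    by (simp add: of_bool_def if_distrib cong: if_cong)
  from DERIV_diff[OF DERIV_tensor_form_direction[OF sym, where y = y and i = i] DERIV_cmult[OF this, of m]]
  have deriv: "(g has_real_derivative D) (at 0)"
    unfolding g_def z_def D_def by (simp add: algebra_simps)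
  have "z 0 = y"
    by (simp add: z_def vec_eq_iff)
  then have g0: "g 0 = 0"
    by (simp add: g_def tight)
  have g_le: "g t \<le> 0" if "- (y $ i) \<le> t" for t
  proof -
    have "0 \<le> z t $ j" for j
      using y[of j] that by (auto simp: z_def)
    then show ?thesis
      using bound[of "z t"] by (simp add: g_def)
  qed
  have "\<not> D > 0"
  proof
    assume "D > 0"
    then obtain d where "d > 0" "\<And>h. h > 0 \<Longrightarrow> h < d \<Longrightarrow> g 0 < g (0 + h)"
      using DERIV_pos_inc_right[OF deriv] by blast
    from this(2)[of "d / 2"] this(1) show False
      using g_le[of "d / 2"] g0 y[of i] by simp
  qed
  moreover have "\<not> D < 0"
  proof
    assume neg: "D < 0"
    show False
    proof (cases "y $ i = 0")
      case True
      then have "D = real k * real_apply k T y i"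
        using \<open>k \<ge> 2\<close> by (simp add: D_def)
      also have "\<dots> \<ge> 0"
        using real_apply_nonneg[OF nonneg y] by simp
      finally show False
        using neg by simp
    next
      case False
      then have pos: "y $ i > 0"
        using y[of i] by simp
      obtain d where "d > 0" "\<And>h. h > 0 \<Longrightarrow> h < d \<Longrightarrow> g 0 < g (0 - h)"
        using DERIV_neg_dec_left[OF deriv neg] by blast
      moreover define h where "h = min (d / 2) (y $ i)"
      ultimately have "g 0 < g (0 - h)"
        using pos by (auto simp: min_def)
      then show False
        using g_le[of "- h"] g0 by (simp add: h_def)
    qed
  qed
  ultimately have "D = 0"
    by simp
  then show ?thesis
    using \<open>k \<ge> 2\<close> by (simp add: D_def)
qed

section \<open>The spectral radius of a nonnegative symmetric tensor\<close>

text \<open>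
  A maximiser over the compact set \<open>y \<ge> 0\<close>, \<open>\<Sum> y\<^sub>j\<^sup>k = 1\<close>. The bound extends from this set to all
  \<open>z \<ge> 0\<close> because both sides are homogeneous of degree \<open>k\<close>.
\<close>

lemma ex_form_maximiser:
  assumes "k \<ge> 1"
  shows "\<exists>m. \<exists>y :: real ^ 'n::finite. (\<forall>j. 0 \<le> y $ j) \<and> y \<noteq> 0 \<and>
      tensor_form k T y = m * (\<Sum>j\<in>UNIV. (y $ j) ^ k) \<and>
      (\<forall>z. (\<forall>j. 0 \<le> z $ j) \<longrightarrow> tensor_form k T z \<le> m * (\<Sum>j\<in>UNIV. (z $ j) ^ k))"
proof -
  define S where "S = {y :: real ^ 'n. (\<forall>j. 0 \<le> y $ j) \<and> (\<Sum>j\<in>UNIV. (y $ j) ^ k) = 1}"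
  have "closed S"
    unfolding S_def
    by (intro closed_Collect_conj closed_Collect_all closed_Collect_le closed_Collect_eq
        continuous_intros)
  moreover have "bounded S"
  proof (rule boundedI)
    fix y assume "y \<in> S"
    then have y: "\<And>j. 0 \<le> y $ j" and sum: "(\<Sum>j\<in>UNIV. (y $ j) ^ k) = 1"
      by (auto simp: S_def)
    have "y $ j \<le> 1" for j
    proof -
      have "(y $ j) ^ k \<le> (\<Sum>j\<in>UNIV. (y $ j) ^ k)"
        by (rule member_le_sum) (auto simp: y)
      then show ?thesis
        using sum y \<open>k \<ge> 1\<close> by (metis one_power2 power_le_one_iff not_one_le_zero)
    qed
    then have "(\<Sum>j\<in>UNIV. \<bar>y $ j\<bar>) \<le> (\<Sum>j\<in>(UNIV :: 'n set). 1)"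
      using y by (intro sum_mono) auto
    then show "norm y \<le> real CARD('n)"
      using norm_le_l1_cart[of y] by simp
  qed
  ultimately have "compact S"
    by (simp add: compact_eq_bounded_closed)
  moreover have "S \<noteq> {}"
  proof -
    have "axis undefined 1 \<in> S"
      using \<open>k \<ge> 1\<close> by (auto simp: S_def axis_def if_distrib[of "\<lambda>a. a ^ k"] power_0_left cong: if_cong)
    then show ?thesis by blast
  qed
  ultimately obtain y where "y \<in> S" and max: "\<And>z. z \<in> S \<Longrightarrow> tensor_form k T z \<le> tensor_form k T y"
    using continuous_attains_sup[OF _ _ continuous_on_tensor_form] by metis
  from \<open>y \<in> S\<close> have y: "\<And>j. 0 \<le> y $ j" and sum: "(\<Sum>j\<in>UNIV. (y $ j) ^ k) = 1"
    by (auto simp: S_def)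
  show ?thesis
  proof (intro exI conjI allI impI)
    show "0 \<le> y $ j" for j by (fact y)
    show "y \<noteq> 0"
      using sum \<open>k \<ge> 1\<close> by (auto simp: power_0_left)
    show "tensor_form k T y = tensor_form k T y * (\<Sum>j\<in>UNIV. (y $ j) ^ k)"
      by (simp add: sum)
  next
    fix z :: "real ^ 'n" assume "\<forall>j. 0 \<le> z $ j"
    then have z: "\<And>j. 0 \<le> z $ j" by blast
    define s where "s = (\<Sum>j\<in>UNIV. (z $ j) ^ k)"
    have "s \<ge> 0"
      unfolding s_def by (intro sum_nonneg zero_le_power z)
    show "tensor_form k T z \<le> tensor_form k T y * (\<Sum>j\<in>UNIV. (z $ j) ^ k)"
    proof (cases "s = 0")
      case True
      then have "\<forall>j. (z $ j) ^ k = 0"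
        unfolding s_def by (subst (asm) sum_nonneg_eq_0_iff) (auto simp: z)
      then have "z = 0 *\<^sub>R z"
        by (auto simp: vec_eq_iff)
      then have "tensor_form k T z = 0 ^ k * tensor_form k T z"
        by (metis tensor_form_scale)
      then show ?thesis
        using True \<open>k \<ge> 1\<close> by (simp add: s_def power_0_left)
    next
      case False
      define c where "c = root k s"
      have c: "c > 0" "c ^ k = s"
        using False \<open>s \<ge> 0\<close> \<open>k \<ge> 1\<close> by (auto simp: c_def)
      have "(1 / c) *\<^sub>R z \<in> S"
        using z c by (auto simp: S_def power_divide sum_divide_distrib[symmetric] s_def[symmetric])
      then have "(1 / c) ^ k * tensor_form k T z \<le> tensor_form k T y"
        using max tensor_form_scale by metis
      then show ?thesis
        using c False \<open>s \<ge> 0\<close> by (simp add: power_divide s_def[symmetric] field_simps)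
    qed
  qed
qed

lemma eigenpair_of_real_iff:
  "eigenpair k T (complex_of_real m) (\<chi> i. complex_of_real (y $ i)) \<longleftrightarrow>
     y \<noteq> 0 \<and> (\<forall>i. real_apply k T y i = m * (y $ i) ^ (k - 1))"
proof -
  have "tensor_apply k T (\<chi> i. complex_of_real (y $ i)) $ i = complex_of_real (real_apply k T y i)"
    for i
    by (simp add: tensor_apply_def real_apply_def of_real_prod_list_map)
  moreover have "(complex_of_real a = complex_of_real m * complex_of_real b ^ n) = (a = m * b ^ n)"
    for a b n
    by (metis of_real_eq_iff of_real_mult of_real_power)
  ultimately show ?thesis
    by (simp add: eigenpair_def vec_eq_iff)
qed

text \<open>Taking absolute values in the eigenvalue equations bounds the eigenvalue by the form.\<close>

lemma cmod_eigenvalue_le: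
  assumes "k \<ge> 1"
    and nonneg: "\<And>js. 0 \<le> T js"
    and bound: "\<And>z. (\<And>j. 0 \<le> z $ j) \<Longrightarrow> tensor_form k T z \<le> m * (\<Sum>j\<in>UNIV. (z $ j) ^ k)"
    and "eigenvalue k T l"
  shows "cmod l \<le> m"
proof -
  from \<open>eigenvalue k T l\<close> obtain x where "x \<noteq> 0"
    and eq: "\<And>i. tensor_apply k T x $ i = l * (x $ i) ^ (k - 1)"
    by (auto simp: eigenvalue_def eigenpair_def)
  define y where "y = (\<chi> i. cmod (x $ i))"
  define s where "s = (\<Sum>i\<in>UNIV. (y $ i) ^ k)"
  have y: "\<And>j. 0 \<le> y $ j"
    by (simp add: y_def)
  have abs: "(\<Prod>j\<leftarrow>js. cmod (x $ j)) = (\<Prod>j\<leftarrow>js. y $ j)" for js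
    by (induction js) (simp_all add: y_def)
  have "cmod l * (y $ i) ^ (k - 1) \<le> real_apply k T y i" for i
  proof -
    have "cmod l * (y $ i) ^ (k - 1) = cmod (tensor_apply k T x $ i)"
      by (simp add: eq y_def norm_mult norm_power)
    also have "\<dots> \<le> real_apply k T y i"
      unfolding tensor_apply_def real_apply_def vec_lambda_beta
      by (rule order_trans[OF norm_sum])
         (auto simp: norm_mult norm_prod_list_map abs nonneg)
    finally show ?thesis .
  qed
  then have "(\<Sum>i\<in>UNIV. y $ i * (cmod l * (y $ i) ^ (k - 1))) \<le> tensor_form k T y"
    unfolding tensor_form_eq_sum_apply[OF \<open>k \<ge> 1\<close>]
    by (intro sum_mono mult_left_mono y)
  also have "(\<Sum>i\<in>UNIV. y $ i * (cmod l * (y $ i) ^ (k - 1))) = cmod l * s"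
    unfolding s_def sum_distrib_left using \<open>k \<ge> 1\<close>
    by (intro sum.cong) (auto simp: power_eq_if)
  finally have "cmod l * s \<le> m * s"
    using bound[OF y] by (simp add: s_def)
  moreover have "s > 0"
  proof -
    obtain i where "x $ i \<noteq> 0"
      using \<open>x \<noteq> 0\<close> by (auto simp: vec_eq_iff)
    then show ?thesis
      unfolding s_def by (intro sum_pos2[of _ i]) (auto simp: y_def)
  qed
  ultimately show ?thesis
    by simp
qed

text \<open>
  The maximum of the form is an eigenvalue and bounds all others, so it is the spectral radius; in
  particular the greatest modulus in \<^const>\<open>spectral_radius\<close> exists.
\<close>

lemma tensor_form_le_spectral_radius:
  fixes z :: "real ^ 'n::finite"
  assumes "k \<ge> 2"
    and nonneg: "\<And>js. 0 \<le> T js"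
    and sym: "\<And>js js'. length js = k \<Longrightarrow> mset js = mset js' \<Longrightarrow> T js = T js'"
    and z: "\<And>j. 0 \<le> z $ j"
  shows "tensor_form k T z \<le> spectral_radius k T * (\<Sum>j\<in>UNIV. (z $ j) ^ k)"
proof -
  from \<open>k \<ge> 2\<close> have "k \<ge> 1" by simp
  obtain m and y :: "real ^ 'n" where y: "\<And>j. 0 \<le> y $ j" "y \<noteq> 0"
    and tight: "tensor_form k T y = m * (\<Sum>j\<in>UNIV. (y $ j) ^ k)"
    and bound: "\<And>z :: real ^ 'n. (\<And>j. 0 \<le> z $ j) \<Longrightarrow> tensor_form k T z \<le> m * (\<Sum>j\<in>UNIV. (z $ j) ^ k)"
    using ex_form_maximiser[OF \<open>k \<ge> 1\<close>, of T] by metis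
  have "real_apply k T y i = m * (y $ i) ^ (k - 1)" for i
    by (rule form_maximiser_eigen) (use assms(1-3) bound y tight in auto)
  then have ev: "eigenvalue k T (complex_of_real m)"
    unfolding eigenvalue_def using eigenpair_of_real_iff y by blast
  have le: "cmod l \<le> m" if "eigenvalue k T l" for l
    using cmod_eigenvalue_le[OF \<open>k \<ge> 1\<close> nonneg bound that] .
  have "m = cmod (complex_of_real m)"
    using le[OF ev] by simp
  with ev le have "spectral_radius k T = m"
    unfolding spectral_radius_def by (intro Greatest_equality) auto
  with bound z show ?thesis by simp
qed

section \<open>Tensors that are sums over the edges\<close>

text \<open>
  A nonnegative symmetric tensor \<open>t e\<close> of order \<open>k\<close> is attached to every vertex set \<open>e\<close>. It is
  supported on lists of vertices of \<open>e\<close>, and attaching it commutes with permutations of the vertices.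
  The assumption \<open>positive\<close> says that every vertex of an edge occurs in a nonzero entry; it is what
  makes the comparison of spectral radii strict.
\<close>

locale edge_kernel =
  fixes k :: nat and t :: "'n::finite set \<Rightarrow> 'n tensor"
  assumes order: "k \<ge> 2"
    and nonneg: "0 \<le> t e js"
    and symmetric: "length js = k \<Longrightarrow> mset js = mset js' \<Longrightarrow> t e js = t e js'"
    and support: "length js = k \<Longrightarrow> t e js \<noteq> 0 \<Longrightarrow> set js \<subseteq> e"
    and natural: "bij \<sigma> \<Longrightarrow> length js = k \<Longrightarrow> t (\<sigma> ` e) (map \<sigma> js) = t e js"
    and positive: "card e = k \<Longrightarrow> i \<in> e \<Longrightarrow> \<exists>js. length js = k - 1 \<and> 0 < t e (i # js)"
begin

text \<open>The tensor of the hypergraph with edge set \<open>E\<close>.\<close>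

definition edge_sum :: "'n set set \<Rightarrow> 'n tensor" where
  "edge_sum E js = (\<Sum>e\<in>E. t e js)"

lemma tensor_form_edge_sum:
  "tensor_form k (edge_sum E) x = (\<Sum>e\<in>E. tensor_form k (t e) x)"
  unfolding tensor_form_def edge_sum_def sum_distrib_right by (rule sum.swap)

lemma real_apply_edge_sum:
  "real_apply k (edge_sum E) x i = (\<Sum>e\<in>E. real_apply k (t e) x i)"
  unfolding real_apply_def edge_sum_def sum_distrib_right by (rule sum.swap)

lemma edge_sum_nonneg: "0 \<le> edge_sum E js"
  unfolding edge_sum_def by (intro sum_nonneg nonneg)

lemma edge_sum_symmetric:
  "length js = k \<Longrightarrow> mset js = mset js' \<Longrightarrow> edge_sum E js = edge_sum E js'"
  unfolding edge_sum_def by (intro sum.cong symmetric) auto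

lemma real_apply_eq_0:
  assumes "i \<notin> e"
  shows "real_apply k (t e) x i = 0"
proof -
  have "t e (i # js) = 0" if "length js = k - 1" for js
    using support[of "i # js" e] that assms order by auto
  then show ?thesis
    by (simp add: real_apply_def)
qed

lemma real_apply_pos:
  assumes "card e = k" and "i \<in> e" and x: "\<And>j. 0 < x $ j"
  shows "0 < real_apply k (t e) x i"
proof -
  obtain js where "length js = k - 1" "0 < t e (i # js)"
    using positive assms by blast
  then show ?thesis
    unfolding real_apply_def
    by (intro sum_pos2[of _ js])
       (auto intro!: mult_pos_pos mult_nonneg_nonneg prod_list_map_pos prod_list_map_nonneg
          nonneg x less_imp_le[OF x])
qed

text \<open>
  The transposition of \<open>v\<close> and \<open>u\<close> matches the monomials of the two forms, and each factor \<open>x\<^sub>v\<close>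
  becomes \<open>x\<^sub>u \<ge> x\<^sub>v\<close>. It is applied to index lists, so no entry has to be computed and vertices
  may be repeated.
\<close>

lemma tensor_form_moved_le:
  fixes x :: "real ^ 'n"
  assumes "u \<notin> e" and "v \<in> e" and x: "\<And>j. 0 < x $ j" and "x $ v \<le> x $ u"
  shows "tensor_form k (t e) x \<le> tensor_form k (t ((e - {v}) \<union> {u})) x"
proof -
  define \<sigma> where "\<sigma> = Transposition.transpose u v"
  have "bij \<sigma>" and invol: "\<sigma> (\<sigma> j) = j" for j
    by (simp_all add: \<sigma>_def)
  have inv_map: "map \<sigma> (map \<sigma> js) = js" for js
    by (simp add: invol comp_def)
  have img: "\<sigma> ` e = (e - {v}) \<union> {u}"
    using assms(1,2) by (force simp: \<sigma>_def Transposition.transpose_def image_iff)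
  have le: "x $ j \<le> x $ \<sigma> j" if "j \<in> e" for j
    using that assms by (auto simp: \<sigma>_def Transposition.transpose_def)
  have "tensor_form k (t e) x \<le> (\<Sum>js | length js = k. t e js * (\<Prod>j\<leftarrow>js. x $ \<sigma> j))"
    unfolding tensor_form_def
  proof (rule sum_mono)
    fix js :: "'n list" assume "js \<in> {js. length js = k}"
    then have len: "length js = k" by simp
    show "t e js * (\<Prod>j\<leftarrow>js. x $ j) \<le> t e js * (\<Prod>j\<leftarrow>js. x $ \<sigma> j)"
    proof (cases "t e js = 0")
      case False
      then have "set js \<subseteq> e"
        using support[OF len] by simp
      then show ?thesis
        using le x by (intro mult_left_mono nonneg prod_list_map_mono) (auto intro: less_imp_le)
    qed simp
  qed
  also have "\<dots> = (\<Sum>js | length js = k. t (\<sigma> ` e) (map \<sigma> js) * (\<Prod>j\<leftarrow>map \<sigma> js. x $ j))"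
    by (intro sum.cong) (auto simp: natural[OF \<open>bij \<sigma>\<close>] comp_def)
  also have "\<dots> = tensor_form k (t (\<sigma> ` e)) x"
    unfolding tensor_form_def
    by (rule sum.reindex_bij_witness[where i = "map \<sigma>" and j = "map \<sigma>"])
       (auto simp: inv_map simp del: map_map)
  finally show ?thesis
    unfolding img .
qed

text \<open>
  The vector \<open>x\<close> serves as a test vector for the form of the new hypergraph. Equality of the spectral
  radii would make it a maximiser there, which the eigenvalue equation at \<open>u\<close> rules out.
\<close>

lemma spectral_radius_less_move_edges:
  assumes "r \<ge> 1" and "uniform k E" and mov: "movable E r e v u"
    and nomult: "no_multiple_edges E r e v u"
    and x: "principal_eigenvector k (edge_sum E) x"
    and max: "x $ u \<ge> Max ((\<lambda>i. x $ v i) ` {1..r})"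
  shows "spectral_radius k (edge_sum (move_edges E r e v u)) > spectral_radius k (edge_sum E)"
proof -
  define E' where "E' = move_edges E r e v u"
  define R where "R = E - e ` {1..r}"
  define \<rho> where "\<rho> = spectral_radius k (edge_sum E)"
  define \<rho>' where "\<rho>' = spectral_radius k (edge_sum E')"
  have inj: "inj_on e {1..r}" "inj_on (moved_edge e v u) {1..r}"
    and ei: "\<And>i. i \<in> {1..r} \<Longrightarrow> e i \<in> E \<and> u \<notin> e i \<and> v i \<in> e i"
    and new: "\<And>i. i \<in> {1..r} \<Longrightarrow> moved_edge e v u i \<notin> R"
    using mov nomult by (auto simp: movable_def no_multiple_edges_def R_def)
  have xv: "x $ v i \<le> x $ u" if "i \<in> {1..r}" for i
    using max Max_ge[of "(\<lambda>i. x $ v i) ` {1..r}" "x $ v i"] that by force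
  have pos: "\<And>j. 0 < x $ j" and sum1: "(\<Sum>j\<in>UNIV. (x $ j) ^ k) = 1"
    and eigen: "\<And>i. real_apply k (edge_sum E) x i = \<rho> * (x $ i) ^ (k - 1)"
    using x by (auto simp: principal_eigenvector_def eigenpair_of_real_iff \<rho>_def)
  have nonneg_x: "\<And>j. 0 \<le> x $ j"
    using pos less_imp_le by blast
  have sum_E: "(\<Sum>a\<in>E. f a) = (\<Sum>a\<in>R. f a) + (\<Sum>i\<in>{1..r}. f (e i))" for f :: "'n set \<Rightarrow> real"
  proof -
    have "E = R \<union> e ` {1..r}" "R \<inter> e ` {1..r} = {}"
      using ei by (auto simp: R_def)
    then have "(\<Sum>a\<in>E. f a) = (\<Sum>a\<in>R. f a) + (\<Sum>a\<in>e ` {1..r}. f a)"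
      by (metis finite sum.union_disjoint)
    then show ?thesis
      using sum.reindex[OF inj(1), of f] by simp
  qed
  have sum_E': "(\<Sum>a\<in>E'. f a) = (\<Sum>a\<in>R. f a) + (\<Sum>i\<in>{1..r}. f (moved_edge e v u i))"
    for f :: "'n set \<Rightarrow> real"
  proof -
    have "E' = R \<union> moved_edge e v u ` {1..r}" "R \<inter> moved_edge e v u ` {1..r} = {}"
      using new by (auto simp: R_def E'_def move_edges_def)
    then have "(\<Sum>a\<in>E'. f a) = (\<Sum>a\<in>R. f a) + (\<Sum>a\<in>moved_edge e v u ` {1..r}. f a)"
      by (metis finite sum.union_disjoint)
    then show ?thesis
      using sum.reindex[OF inj(2), of f] by simp
  qed

  have "\<rho> = tensor_form k (edge_sum E) x"
  proof -
    have "tensor_form k (edge_sum E) x = (\<Sum>i\<in>UNIV. \<rho> * (x $ i) ^ k)"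
      using order by (auto simp: tensor_form_eq_sum_apply eigen power_eq_if intro!: sum.cong)
    then show ?thesis
      by (simp add: sum_distrib_left[symmetric] sum1)
  qed
  also have "\<dots> \<le> tensor_form k (edge_sum E') x"
    unfolding tensor_form_edge_sum sum_E sum_E' moved_edge_def
    by (intro add_left_mono sum_mono tensor_form_moved_le) (use ei pos xv in auto)
  finally have form_ge: "\<rho> \<le> tensor_form k (edge_sum E') x" .
  have bound: "tensor_form k (edge_sum E') z \<le> \<rho>' * (\<Sum>j\<in>UNIV. (z $ j) ^ k)"
    if "\<And>j. 0 \<le> z $ j" for z
    unfolding \<rho>'_def
    by (rule tensor_form_le_spectral_radius[OF order edge_sum_nonneg edge_sum_symmetric that])
  have "\<rho> \<le> \<rho>'"
    using form_ge bound[OF nonneg_x] by (simp add: sum1)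
  moreover have "\<rho> \<noteq> \<rho>'"
  proof
    assume eq: "\<rho> = \<rho>'"
    then have tight: "tensor_form k (edge_sum E') x = \<rho>' * (\<Sum>j\<in>UNIV. (x $ j) ^ k)"
      using form_ge bound[OF nonneg_x] by (simp add: sum1)
    have "real_apply k (edge_sum E') x u = \<rho>' * (x $ u) ^ (k - 1)"
      by (rule form_maximiser_eigen[OF order edge_sum_nonneg edge_sum_symmetric bound nonneg_x tight])
    then have "real_apply k (edge_sum E') x u = real_apply k (edge_sum E) x u"
      by (simp add: eigen eq)
    moreover have "real_apply k (t (e i)) x u = 0" if "i \<in> {1..r}" for i
      using ei[OF that] by (simp add: real_apply_eq_0)
    \<comment> \<open>Subtracting the two equations at \<open>u\<close> leaves the contribution of the moved edges.\<close>
    ultimately have "(\<Sum>i\<in>{1..r}. real_apply k (t (moved_edge e v u i)) x u) = 0"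
      by (simp add: real_apply_edge_sum sum_E sum_E')
    moreover have "(\<Sum>i\<in>{1..r}. real_apply k (t (moved_edge e v u i)) x u) > 0"
    proof (rule sum_pos)
      fix i assume i: "i \<in> {1..r}"
      have "card (e i) = k"
        using ei[OF i] \<open>uniform k E\<close> by (simp add: uniform_def)
      then have "card (moved_edge e v u i) = k"
        using ei[OF i] order by (simp add: moved_edge_def)
      then show "real_apply k (t (moved_edge e v u i)) x u > 0"
        by (rule real_apply_pos) (simp_all add: moved_edge_def pos)
    qed (use \<open>r \<ge> 1\<close> in auto)
    ultimately show False
      by simp
  qed
  ultimately show ?thesis
    by (simp add: \<rho>_def \<rho>'_def E'_def)
qed

end

section \<open>The three tensors of a hypergraph\<close>

text \<open>
  The contributions of a single edge \<open>e\<close> to the adjacency tensor, to the diagonal tensor of the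
  degrees and to the incidence \<open>Q\<close>-tensor.
\<close>

definition adjacency_kernel :: "nat \<Rightarrow> 'n::finite set \<Rightarrow> 'n tensor" where
  "adjacency_kernel k e js = (if set js = e then 1 / fact (k - 1) else 0)"

definition degree_kernel :: "nat \<Rightarrow> 'n::finite set \<Rightarrow> 'n tensor" where
  "degree_kernel k e js = (if \<exists>i\<in>e. js = replicate k i then 1 else 0)"

definition incidence_kernel :: "nat \<Rightarrow> 'n::finite set \<Rightarrow> 'n tensor" where
  "incidence_kernel k e js = (if \<forall>t<k. js ! t \<in> e then 1 else 0)"

lemma adjacency_kernel_map:
  "bij \<sigma> \<Longrightarrow> adjacency_kernel k (\<sigma> ` e) (map \<sigma> js) = adjacency_kernel k e js"
  by (simp add: adjacency_kernel_def inj_image_eq_iff bij_is_inj)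

lemma adjacency_kernel_mset:
  "mset js = mset js' \<Longrightarrow> adjacency_kernel k e js = adjacency_kernel k e js'"
  by (metis adjacency_kernel_def mset_eq_setD)

lemma degree_kernel_eq:
  assumes "k \<ge> 1"
  shows "degree_kernel k e js = (if length js = k \<and> (\<exists>i\<in>e. set js = {i}) then 1 else 0)"
proof -
  have "js = replicate k i \<longleftrightarrow> length js = k \<and> set js = {i}" for i
  proof
    assume "length js = k \<and> set js = {i}"
    then show "js = replicate k i"
      by (intro replicate_eqI) auto
  qed (use assms in simp)
  then show ?thesis
    by (auto simp: degree_kernel_def)
qed

lemma degree_kernel_map:
  assumes "k \<ge> 1" and "bij \<sigma>"
  shows "degree_kernel k (\<sigma> ` e) (map \<sigma> js) = degree_kernel k e js"
proof -
  have "\<sigma> ` set js = {\<sigma> i} \<longleftrightarrow> set js = {i}" for i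
    using inj_image_eq_iff[OF bij_is_inj[OF \<open>bij \<sigma>\<close>], of "set js" "{i}"] by simp
  then show ?thesis
    by (simp add: degree_kernel_eq[OF \<open>k \<ge> 1\<close>])
qed

lemma degree_kernel_mset:
  "k \<ge> 1 \<Longrightarrow> mset js = mset js' \<Longrightarrow> degree_kernel k e js = degree_kernel k e js'"
  using mset_eq_setD[of js js'] mset_eq_length[of js js'] by (simp add: degree_kernel_eq)

lemma incidence_kernel_eq:
  "length js = k \<Longrightarrow> incidence_kernel k e js = (if set js \<subseteq> e then 1 else 0)"
  by (auto simp: incidence_kernel_def set_conv_nth)

lemma edge_kernel_adjacency:
  assumes "k \<ge> 2"
  shows "edge_kernel k (adjacency_kernel k)"
proof
  fix e :: "'a set" and i assume "card e = k" "i \<in> e"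
  \<comment> \<open>an enumeration of the other vertices of \<open>e\<close>\<close>
  obtain js where js: "set js = e - {i}" "length js = card (e - {i})"
    using finite_distinct_list[of "e - {i}"] distinct_card by (metis finite)
  then have "length js = k - 1" "0 < adjacency_kernel k e (i # js)"
    using \<open>card e = k\<close> \<open>i \<in> e\<close> by (auto simp: adjacency_kernel_def)
  then show "\<exists>js. length js = k - 1 \<and> 0 < adjacency_kernel k e (i # js)"
    by blast
qed (use assms in \<open>auto simp: adjacency_kernel_map intro: adjacency_kernel_mset\<close>,
     auto simp: adjacency_kernel_def split: if_splits)

text \<open>
  The diagonal part satisfies \<open>positive\<close> already, so the adjacency part need only be nonnegative.
\<close>

lemma edge_kernel_signless_laplacian:
  assumes "k \<ge> 2"
  shows "edge_kernel k (\<lambda>e js. degree_kernel k e js + adjacency_kernel k e js)"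
proof
  have "k \<ge> 1" using assms by simp
  show "k \<ge> 2" by fact
  fix e :: "'a set" and js js' :: "'a list"
  show "0 \<le> degree_kernel k e js + adjacency_kernel k e js"
    by (simp add: degree_kernel_def adjacency_kernel_def)
  show "degree_kernel k e js + adjacency_kernel k e js
      = degree_kernel k e js' + adjacency_kernel k e js'" if "mset js = mset js'"
    using degree_kernel_mset[OF \<open>k \<ge> 1\<close> that] adjacency_kernel_mset[OF that] by metis
  show "set js \<subseteq> e" if "degree_kernel k e js + adjacency_kernel k e js \<noteq> 0"
    using that by (auto simp: degree_kernel_def adjacency_kernel_def split: if_splits)
  show "degree_kernel k (\<sigma> ` e) (map \<sigma> js) + adjacency_kernel k (\<sigma> ` e) (map \<sigma> js)
      = degree_kernel k e js + adjacency_kernel k e js" if "bij \<sigma>" for \<sigma> :: "'a \<Rightarrow> 'a"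
    by (simp add: degree_kernel_map[OF \<open>k \<ge> 1\<close> that] adjacency_kernel_map[OF that])
  show "\<exists>js. length js = k - 1 \<and> 0 < degree_kernel k e (i # js) + adjacency_kernel k e (i # js)"
    if "i \<in> e" for i
  proof (intro exI conjI)
    have "i # replicate (k - 1) i = replicate k i"
      using \<open>k \<ge> 1\<close> by (cases k) auto
    then have "degree_kernel k e (i # replicate (k - 1) i) = 1"
      using that by (auto simp: degree_kernel_def)
    moreover have "0 \<le> adjacency_kernel k e (i # replicate (k - 1) i)"
      by (simp add: adjacency_kernel_def)
    ultimately show "0 < degree_kernel k e (i # replicate (k - 1) i)
        + adjacency_kernel k e (i # replicate (k - 1) i)"
      by linarith
  qed simp
qed

lemma edge_kernel_incidence:
  assumes "k \<ge> 2"
  shows "edge_kernel k (incidence_kernel k)"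
proof
  show "k \<ge> 2" by fact
  fix e :: "'a set" and js js' :: "'a list"
  show "0 \<le> incidence_kernel k e js"
    by (simp add: incidence_kernel_def)
  show "incidence_kernel k e js = incidence_kernel k e js'"
    if "length js = k" "mset js = mset js'"
    using that mset_eq_setD[of js js'] mset_eq_length[of js js'] by (simp add: incidence_kernel_eq)
  show "set js \<subseteq> e" if "length js = k" "incidence_kernel k e js \<noteq> 0"
    using that by (simp add: incidence_kernel_eq split: if_splits)
  show "incidence_kernel k (\<sigma> ` e) (map \<sigma> js) = incidence_kernel k e js"
    if "bij \<sigma>" "length js = k" for \<sigma> :: "'a \<Rightarrow> 'a"
    using that by (simp add: incidence_kernel_eq inj_image_subset_iff bij_is_inj)
  show "\<exists>js. length js = k - 1 \<and> 0 < incidence_kernel k e (i # js)" if "i \<in> e" for i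
    using that \<open>k \<ge> 2\<close>
    by (intro exI[of _ "replicate (k - 1) i"])
       (auto simp: incidence_kernel_eq set_replicate_conv_if)
qed

lemma adjacency_tensor_eq_sum:
  "adjacency_tensor k E js = (\<Sum>e\<in>E. adjacency_kernel k e js)"
  by (simp add: adjacency_tensor_def adjacency_kernel_def)

lemma degree_tensor_eq_sum:
  assumes "k \<ge> 1"
  shows "degree_tensor k E js = (\<Sum>e\<in>E. degree_kernel k e js)"
proof (cases "\<exists>i. js = replicate k i")
  case True
  then obtain i where i: "js = replicate k i" by blast
  have "(\<exists>j\<in>e. replicate k i = replicate k j) \<longleftrightarrow> i \<in> e" for e
    using assms by (auto simp: replicate_eq_replicate)
  then show ?thesis
    using assms by (auto simp: i degree_tensor_def degree_kernel_def degree_def sum.If_cases Int_def)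
qed (auto simp: degree_tensor_def degree_kernel_def)

lemma incidence_Q_tensor_eq_sum:
  "incidence_Q_tensor k E js = (\<Sum>e\<in>E. incidence_kernel k e js)"
  by (simp add: incidence_Q_tensor_def incidence_kernel_def sum.If_cases Int_def)

theorem theorem15:
  fixes E :: "'n::finite set set" and k r :: nat
    and e :: "nat \<Rightarrow> 'n set" and v :: "nat \<Rightarrow> 'n" and u :: 'n
  assumes "k \<ge> 2" and "r \<ge> 1"
    and "uniform k E" and "hyperconnected E"
    and "movable E r e v u"
    and "no_multiple_edges E r e v u"
  defines "E' \<equiv> move_edges E r e v u"
  shows "(\<forall>x. principal_eigenvector k (adjacency_tensor k E) x \<and>
              x $ u \<ge> Max ((\<lambda>i. x $ v i) ` {1..r}) \<longrightarrow>
              spectral_radius k (adjacency_tensor k E') > spectral_radius k (adjacency_tensor k E))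
       \<and> (\<forall>x. principal_eigenvector k (signless_laplacian_tensor k E) x \<and>
              x $ u \<ge> Max ((\<lambda>i. x $ v i) ` {1..r}) \<longrightarrow>
              spectral_radius k (signless_laplacian_tensor k E')
                > spectral_radius k (signless_laplacian_tensor k E))
       \<and> (\<forall>x. principal_eigenvector k (incidence_Q_tensor k E) x \<and>
              x $ u \<ge> Max ((\<lambda>i. x $ v i) ` {1..r}) \<longrightarrow>
              spectral_radius k (incidence_Q_tensor k E')
                > spectral_radius k (incidence_Q_tensor k E))"
proof -
  interpret A: edge_kernel k "adjacency_kernel k :: 'n set \<Rightarrow> 'n tensor"
    using \<open>k \<ge> 2\<close> by (rule edge_kernel_adjacency)
  interpret Q: edge_kernel k "\<lambda>(e :: 'n set) js. degree_kernel k e js + adjacency_kernel k e js"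
    using \<open>k \<ge> 2\<close> by (rule edge_kernel_signless_laplacian)
  interpret I: edge_kernel k "incidence_kernel k :: 'n set \<Rightarrow> 'n tensor"
    using \<open>k \<ge> 2\<close> by (rule edge_kernel_incidence)
  have "k \<ge> 1"
    using \<open>k \<ge> 2\<close> by simp
  have A: "adjacency_tensor k F = A.edge_sum F" for F :: "'n set set"
    by (rule ext) (simp add: A.edge_sum_def adjacency_tensor_eq_sum)
  have Q: "signless_laplacian_tensor k F = Q.edge_sum F" for F :: "'n set set"
    by (rule ext) (simp add: Q.edge_sum_def signless_laplacian_tensor_def sum.distrib
        adjacency_tensor_eq_sum degree_tensor_eq_sum[OF \<open>k \<ge> 1\<close>])
  have I: "incidence_Q_tensor k F = I.edge_sum F" for F :: "'n set set"
    by (rule ext) (simp add: I.edge_sum_def incidence_Q_tensor_eq_sum)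
  show ?thesis
    unfolding A Q I E'_def
    using A.spectral_radius_less_move_edges[OF assms(2,3,5,6)]
      Q.spectral_radius_less_move_edges[OF assms(2,3,5,6)]
      I.spectral_radius_less_move_edges[OF assms(2,3,5,6)]
    by blast
qed

end
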